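(* Let $\psi\in\mathcal{D}$ be a DQBF and let $\psi_1=\exists y(D_y):(\varphi_1\vee\varphi_2)$ be a subformula of $\psi$. Define $O_{\varphi_1}=\Bigl[(V^\forall_\psi\cap V_{\varphi_1})\cup\bigcup_{v\in V^\exists_\psi\cap V_{\varphi_1}}(V^\forall_\psi\cap D_v)\Bigr]\setminus D_y$, $O_{\varphi_2}=\Bigl[(V^\forall_\psi\cap V_{\varphi_2})\cup\bigcup_{v\in V^\exists_\psi\cap V_{\varphi_2}}(V^\forall_\psi\cap D_v)\Bigr]\setminus D_y$, $O_{\psi\setminus\psi_1}=V^\forall_{\psi[0/\psi_1]}\cup\bigcup_{v\in V^\exists_{\psi[0/\psi_1]}}(V^\forall_\psi\cap D_v)$, where $\psi[0/\psi_1]$ is $\psi$ with the subformula $\psi_1$ replaced by the constant $0$. If $O_{\varphi_1}\cap O_{\varphi_2}=\emptyset$ and ($O_{\varphi_1}\cap O_{\psi\setminus\psi_1}=\emptyset$ or $O_{\varphi_2}\cap O_{\psi\setminus\psi_1}=\emptyset$), then $\psi$ and $\psi'=\psi[\psi_2/\psi_1]$ are equisatisfiable, where $\psi'$ results from $\psi$ by replacing $\psi_1$ by $\psi_2=(\exists y(D_y):\varphi_1)\vee(\exists y'(D_y):\varphi_2[y'/y])$ with $y'$ a fresh variable.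
   Context: Notation: $\mathcal{F}(W)$ is the set of Boolean functions over variable set $W$; $\mathrm{supp}(f)$ the set of variables $f$ depends on. Syntax (non-closed non-prenex DQBFs in NNF over a finite variable set $V$). The set $\mathcal{D}$, with for each $\psi$ the sets $V^{\exists}_\psi$ (existential), $V^{\forall}_\psi$ (universal), $V^{\mathrm{fs}}_\psi$ (free variables occurring in $\psi$), and a dependency set $D_y\subseteq V$ for each existential $y$, is the smallest set closed under: (1) $v\in\mathcal{D}$ for $v\in V$ ($V^\exists=V^\forall=\emptyset$, $V^{\mathrm{fs}}=\{v\}$); (2) $\neg v\in\mathcal{D}$, same sets; (3),(4) if $\varphi_1,\varphi_2\in\mathcal{D}$ and $\bigl(V^Q_{\varphi_1}\cup V^{\mathrm{fs}}_{\varphi_1}\cup\bigcup_{y\in V^\exists_{\varphi_1}}D_y\bigr)\cap V^Q_{\varphi_2}=\emptyset$ and symmetrically, then $(\varphi_1\wedge\varphi_2),(\varphi_1\vee\varphi_2)\in\mathcal{D}$ with all three sets the unions; (5) if $\varphi\in\mathcal{D}$, $v\in V^{\mathrm{free}}_\varphi$, $D_v\subseteq V\setminus(V^Q_\varphi\cup\{v\})$, then $\exists v(D_v):\varphi^{-v}\in\mathcal{D}$ ($\varphi^{-v}$: remove $v$ from all dependency sets in $\varphi$), with $V^\exists=V^\exists_\varphi\cup\{v\}$, $V^{\mathrm{fs}}=V^{\mathrm{fs}}_\varphi\setminus\{v\}$; (6) if $\varphi\in\mathcal{D}$, $v\in V^{\mathrm{free}}_\varphi$, then $\forall v:\varphi\in\mathcal{D}$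 with $V^\forall=V^\forall_\varphi\cup\{v\}$, $V^{\mathrm{fs}}=V^{\mathrm{fs}}_\varphi\setminus\{v\}$. Here $V^Q_\psi=V^\exists_\psi\cup V^\forall_\psi$, $V_\psi=V^Q_\psi\cup V^{\mathrm{fs}}_\psi$, $V^{\mathrm{free}}_\psi=V\setminus V^Q_\psi$. Semantics. A Skolem function candidate for $\psi$ is a map $s:V^{\mathrm{free}}_\psi\cup V^\exists_\psi\to\mathcal{F}(V^\forall_\psi)$ with $s(v)$ constant for free $v$ and $\mathrm{supp}(s(v))\subseteq D_v\cap V^\forall_\psi$ for existential $v$. $s(\psi)$ replaces each such $v$ by $s(v)$ and deletes quantifiers. $[\![\psi]\!]$ is the set of candidates $s$ with $s(\psi)$ a tautology. $\psi_1\approx\psi_2$ (equisatisfiable) iff $[\![\psi_1]\!]=\emptyset\Leftrightarrow[\![\psi_2]\!]=\emptyset$. *)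

theory Defs
  imports Main "HOL-Library.FuncSet"
begin

text \<open>
  Each existential quantifier carries its dependency set. The constant \<open>ZeroF\<close> belongs to no DQBF
  (it is not generated by \<open>dqbf\<close> below); it serves to form \<open>\<psi>[0/\<psi>\<^sub>1]\<close>.
\<close>

datatype 'v form =
    ZeroF
  | PosF 'v
  | NegF 'v
  | AndF "'v form" "'v form"
  | OrF "'v form" "'v form"
  | ExF 'v "'v set" "'v form"
  | AllF 'v "'v form"

primrec exists_vars :: "'v form \<Rightarrow> 'v set" where
  "exists_vars ZeroF = {}"
| "exists_vars (PosF v) = {}"
| "exists_vars (NegF v) = {}"
| "exists_vars (AndF \<phi>1 \<phi>2) = exists_vars \<phi>1 \<union> exists_vars \<phi>2"
| "exists_vars (OrF \<phi>1 \<phi>2) = exists_vars \<phi>1 \<union> exists_vars \<phi>2"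
| "exists_vars (ExF v D \<phi>) = insert v (exists_vars \<phi>)"
| "exists_vars (AllF v \<phi>) = exists_vars \<phi>"

primrec forall_vars :: "'v form \<Rightarrow> 'v set" where
  "forall_vars ZeroF = {}"
| "forall_vars (PosF v) = {}"
| "forall_vars (NegF v) = {}"
| "forall_vars (AndF \<phi>1 \<phi>2) = forall_vars \<phi>1 \<union> forall_vars \<phi>2"
| "forall_vars (OrF \<phi>1 \<phi>2) = forall_vars \<phi>1 \<union> forall_vars \<phi>2"
| "forall_vars (ExF v D \<phi>) = forall_vars \<phi>"
| "forall_vars (AllF v \<phi>) = insert v (forall_vars \<phi>)"

primrec free_supp_vars :: "'v form \<Rightarrow> 'v set" where
  "free_supp_vars ZeroF = {}"
| "free_supp_vars (PosF v) = {v}"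
| "free_supp_vars (NegF v) = {v}"
| "free_supp_vars (AndF \<phi>1 \<phi>2) = free_supp_vars \<phi>1 \<union> free_supp_vars \<phi>2"
| "free_supp_vars (OrF \<phi>1 \<phi>2) = free_supp_vars \<phi>1 \<union> free_supp_vars \<phi>2"
| "free_supp_vars (ExF v D \<phi>) = free_supp_vars \<phi> - {v}"
| "free_supp_vars (AllF v \<phi>) = free_supp_vars \<phi> - {v}"

definition quant_vars :: "'v form \<Rightarrow> 'v set" where
  "quant_vars \<phi> = exists_vars \<phi> \<union> forall_vars \<phi>"

definition vars :: "'v form \<Rightarrow> 'v set" where
  "vars \<phi> = quant_vars \<phi> \<union> free_supp_vars \<phi>"

text \<open>
  Unlike \<open>free_supp_vars\<close>, this contains every variable of \<open>V\<close> that is not quantified,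
  whether or not it occurs in the formula.
\<close>

definition free_vars :: "'v set \<Rightarrow> 'v form \<Rightarrow> 'v set" where
  "free_vars V \<phi> = V - quant_vars \<phi>"

text \<open>
  \<open>dep \<phi> y\<close> is \<open>D\<^sub>y\<close>, read off from the quantifier of \<open>y\<close> in \<open>\<phi>\<close>. In a DQBF every variable is quantified
  at most once, so the unions never merge two different dependency sets.
\<close>

primrec dep :: "'v form \<Rightarrow> 'v \<Rightarrow> 'v set" where
  "dep ZeroF y = {}"
| "dep (PosF v) y = {}"
| "dep (NegF v) y = {}"
| "dep (AndF \<phi>1 \<phi>2) y = dep \<phi>1 y \<union> dep \<phi>2 y"
| "dep (OrF \<phi>1 \<phi>2) y = dep \<phi>1 y \<union> dep \<phi>2 y"
| "dep (ExF v D \<phi>) y = (if y = v then D else {}) \<union> dep \<phi> y"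
| "dep (AllF v \<phi>) y = dep \<phi> y"

text \<open>\<open>remove_dep v \<phi>\<close> is \<open>\<phi>\<^sup>-\<^sup>v\<close>.\<close>

primrec remove_dep :: "'v \<Rightarrow> 'v form \<Rightarrow> 'v form" where
  "remove_dep v ZeroF = ZeroF"
| "remove_dep v (PosF w) = PosF w"
| "remove_dep v (NegF w) = NegF w"
| "remove_dep v (AndF \<phi>1 \<phi>2) = AndF (remove_dep v \<phi>1) (remove_dep v \<phi>2)"
| "remove_dep v (OrF \<phi>1 \<phi>2) = OrF (remove_dep v \<phi>1) (remove_dep v \<phi>2)"
| "remove_dep v (ExF w D \<phi>) = ExF w (D - {v}) (remove_dep v \<phi>)"
| "remove_dep v (AllF w \<phi>) = AllF w (remove_dep v \<phi>)"

definition combinable :: "'v form \<Rightarrow> 'v form \<Rightarrow> bool" where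
  "combinable \<phi>1 \<phi>2 \<longleftrightarrow>
     (quant_vars \<phi>1 \<union> free_supp_vars \<phi>1 \<union> (\<Union>y\<in>exists_vars \<phi>1. dep \<phi>1 y)) \<inter> quant_vars \<phi>2 = {} \<and>
     (quant_vars \<phi>2 \<union> free_supp_vars \<phi>2 \<union> (\<Union>y\<in>exists_vars \<phi>2. dep \<phi>2 y)) \<inter> quant_vars \<phi>1 = {}"

inductive_set dqbf :: "'v set \<Rightarrow> 'v form set" for V :: "'v set" where
  pos: "v \<in> V \<Longrightarrow> PosF v \<in> dqbf V"
| neg: "v \<in> V \<Longrightarrow> NegF v \<in> dqbf V"
| conj: "\<lbrakk>\<phi>1 \<in> dqbf V; \<phi>2 \<in> dqbf V; combinable \<phi>1 \<phi>2\<rbrakk> \<Longrightarrow> AndF \<phi>1 \<phi>2 \<in> dqbf V"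
| disj: "\<lbrakk>\<phi>1 \<in> dqbf V; \<phi>2 \<in> dqbf V; combinable \<phi>1 \<phi>2\<rbrakk> \<Longrightarrow> OrF \<phi>1 \<phi>2 \<in> dqbf V"
| exists: "\<lbrakk>\<phi> \<in> dqbf V; v \<in> free_vars V \<phi>; D \<subseteq> V - (quant_vars \<phi> \<union> {v})\<rbrakk>
    \<Longrightarrow> ExF v D (remove_dep v \<phi>) \<in> dqbf V"
| forall: "\<lbrakk>\<phi> \<in> dqbf V; v \<in> free_vars V \<phi>\<rbrakk> \<Longrightarrow> AllF v \<phi> \<in> dqbf V"

text \<open>
  A Boolean function over \<open>W\<close> is represented by a function of assignments to all variables that
  depends on the variables in \<open>W\<close> only.
\<close>

definition bool_funs :: "'v set \<Rightarrow> (('v \<Rightarrow> bool) \<Rightarrow> bool) set" where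
  "bool_funs W = {f. \<forall>a b. (\<forall>w\<in>W. a w = b w) \<longrightarrow> f a = f b}"

definition supp :: "(('v \<Rightarrow> bool) \<Rightarrow> bool) \<Rightarrow> 'v set" where
  "supp f = {v. \<exists>a. f (a(v := False)) \<noteq> f (a(v := True))}"

definition skolem_candidates :: "'v set \<Rightarrow> 'v form \<Rightarrow> ('v \<Rightarrow> ('v \<Rightarrow> bool) \<Rightarrow> bool) set" where
  "skolem_candidates V \<psi> =
     {s \<in> (free_vars V \<psi> \<union> exists_vars \<psi>) \<rightarrow>\<^sub>E bool_funs (forall_vars \<psi>).
        (\<forall>v\<in>free_vars V \<psi>. \<exists>c. s v = (\<lambda>a. c)) \<and>
        (\<forall>v\<in>exists_vars \<psi>. supp (s v) \<subseteq> dep \<psi> v \<inter> forall_vars \<psi>)}"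

text \<open>\<open>apply_skolem X s \<phi>\<close> deletes the quantifiers of \<open>\<phi>\<close> and replaces each variable \<open>v \<in> X\<close> by \<open>s v\<close>.\<close>

primrec apply_skolem ::
  "'v set \<Rightarrow> ('v \<Rightarrow> ('v \<Rightarrow> bool) \<Rightarrow> bool) \<Rightarrow> 'v form \<Rightarrow> ('v \<Rightarrow> bool) \<Rightarrow> bool" where
  "apply_skolem X s ZeroF = (\<lambda>a. False)"
| "apply_skolem X s (PosF v) = (if v \<in> X then s v else (\<lambda>a. a v))"
| "apply_skolem X s (NegF v) = (\<lambda>a. \<not> (if v \<in> X then s v else (\<lambda>a. a v)) a)"
| "apply_skolem X s (AndF \<phi>1 \<phi>2) = (\<lambda>a. apply_skolem X s \<phi>1 a \<and> apply_skolem X s \<phi>2 a)"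
| "apply_skolem X s (OrF \<phi>1 \<phi>2) = (\<lambda>a. apply_skolem X s \<phi>1 a \<or> apply_skolem X s \<phi>2 a)"
| "apply_skolem X s (ExF v D \<phi>) = apply_skolem X s \<phi>"
| "apply_skolem X s (AllF v \<phi>) = apply_skolem X s \<phi>"

definition skolem_funs :: "'v set \<Rightarrow> 'v form \<Rightarrow> ('v \<Rightarrow> ('v \<Rightarrow> bool) \<Rightarrow> bool) set" where
  "skolem_funs V \<psi> =
     {s \<in> skolem_candidates V \<psi>. \<forall>a. apply_skolem (free_vars V \<psi> \<union> exists_vars \<psi>) s \<psi> a}"

text \<open>
  The two formulas may be taken over different variable sets, because a fresh variable
  need not belong to the original one.
\<close>

definition equisat :: "'v set \<Rightarrow> 'v form \<Rightarrow> 'v set \<Rightarrow> 'v form \<Rightarrow> bool" where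
  "equisat V1 \<psi>1 V2 \<psi>2 \<longleftrightarrow> (skolem_funs V1 \<psi>1 = {} \<longleftrightarrow> skolem_funs V2 \<psi>2 = {})"

primrec subformulas :: "'v form \<Rightarrow> 'v form set" where
  "subformulas ZeroF = {ZeroF}"
| "subformulas (PosF v) = {PosF v}"
| "subformulas (NegF v) = {NegF v}"
| "subformulas (AndF \<phi>1 \<phi>2) = insert (AndF \<phi>1 \<phi>2) (subformulas \<phi>1 \<union> subformulas \<phi>2)"
| "subformulas (OrF \<phi>1 \<phi>2) = insert (OrF \<phi>1 \<phi>2) (subformulas \<phi>1 \<union> subformulas \<phi>2)"
| "subformulas (ExF v D \<phi>) = insert (ExF v D \<phi>) (subformulas \<phi>)"
| "subformulas (AllF v \<phi>) = insert (AllF v \<phi>) (subformulas \<phi>)"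

text \<open>
  \<open>replace \<chi> \<psi>\<^sub>1 \<psi>\<close> is \<open>\<psi>[\<chi>/\<psi>\<^sub>1]\<close>. It replaces all occurrences of \<open>\<psi>\<^sub>1\<close>; a quantified subformula of a DQBF
  occurs only once, since no variable is quantified twice.
\<close>

primrec replace :: "'v form \<Rightarrow> 'v form \<Rightarrow> 'v form \<Rightarrow> 'v form" where
  "replace \<chi> \<psi>1 ZeroF = (if ZeroF = \<psi>1 then \<chi> else ZeroF)"
| "replace \<chi> \<psi>1 (PosF v) = (if PosF v = \<psi>1 then \<chi> else PosF v)"
| "replace \<chi> \<psi>1 (NegF v) = (if NegF v = \<psi>1 then \<chi> else NegF v)"
| "replace \<chi> \<psi>1 (AndF \<phi>1 \<phi>2) =
     (if AndF \<phi>1 \<phi>2 = \<psi>1 then \<chi> else AndF (replace \<chi> \<psi>1 \<phi>1) (replace \<chi> \<psi>1 \<phi>2))"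
| "replace \<chi> \<psi>1 (OrF \<phi>1 \<phi>2) =
     (if OrF \<phi>1 \<phi>2 = \<psi>1 then \<chi> else OrF (replace \<chi> \<psi>1 \<phi>1) (replace \<chi> \<psi>1 \<phi>2))"
| "replace \<chi> \<psi>1 (ExF v D \<phi>) = (if ExF v D \<phi> = \<psi>1 then \<chi> else ExF v D (replace \<chi> \<psi>1 \<phi>))"
| "replace \<chi> \<psi>1 (AllF v \<phi>) = (if AllF v \<phi> = \<psi>1 then \<chi> else AllF v (replace \<chi> \<psi>1 \<phi>))"

text \<open>
  \<open>rename_var y' y \<phi>\<close> is \<open>\<phi>[y'/y]\<close>. It is applied only where \<open>y\<close> is neither quantified in \<open>\<phi>\<close> nor contained
  in a dependency set of \<open>\<phi>\<close> (the rule \<open>dqbf.exists\<close> ensures both below a quantifier of \<open>y\<close>), so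
  all occurrences of \<open>y\<close> are in literals.
\<close>

primrec rename_var :: "'v \<Rightarrow> 'v \<Rightarrow> 'v form \<Rightarrow> 'v form" where
  "rename_var y' y ZeroF = ZeroF"
| "rename_var y' y (PosF v) = PosF (if v = y then y' else v)"
| "rename_var y' y (NegF v) = NegF (if v = y then y' else v)"
| "rename_var y' y (AndF \<phi>1 \<phi>2) = AndF (rename_var y' y \<phi>1) (rename_var y' y \<phi>2)"
| "rename_var y' y (OrF \<phi>1 \<phi>2) = OrF (rename_var y' y \<phi>1) (rename_var y' y \<phi>2)"
| "rename_var y' y (ExF v D \<phi>) = ExF v D (rename_var y' y \<phi>)"
| "rename_var y' y (AllF v \<phi>) = AllF v (rename_var y' y \<phi>)"

text \<open>
  \<open>O_sub \<psi> D\<^sub>y \<phi>\<^sub>i\<close> is \<open>O\<^bsub>\<phi>\<^sub>i\<^esub>\<close> and \<open>O_rest \<psi> \<psi>\<^sub>1\<close> is \<open>O\<^bsub>\<psi>\<setminus>\<psi>\<^sub>1\<^esub>\<close>.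
  The dependency sets are those of the whole formula \<open>\<psi>\<close>: an existential variable of \<open>\<psi>\<close> that
  occurs in \<open>\<phi>\<^sub>i\<close> may be quantified outside of \<open>\<phi>\<^sub>i\<close>.
\<close>

definition O_sub :: "'v form \<Rightarrow> 'v set \<Rightarrow> 'v form \<Rightarrow> 'v set" where
  "O_sub \<psi> Dy \<phi> =
     ((forall_vars \<psi> \<inter> vars \<phi>) \<union> (\<Union>v \<in> exists_vars \<psi> \<inter> vars \<phi>. forall_vars \<psi> \<inter> dep \<psi> v)) - Dy"

definition O_rest :: "'v form \<Rightarrow> 'v form \<Rightarrow> 'v set" where
  "O_rest \<psi> \<psi>1 =
     forall_vars (replace ZeroF \<psi>1 \<psi>) \<union>
     (\<Union>v \<in> exists_vars (replace ZeroF \<psi>1 \<psi>). forall_vars \<psi> \<inter> dep \<psi> v)"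

definition fresh :: "'v \<Rightarrow> 'v form \<Rightarrow> bool" where
  "fresh x \<psi> \<longleftrightarrow> x \<notin> vars \<psi> \<and> (\<forall>v\<in>exists_vars \<psi>. x \<notin> dep \<psi> v)"

end

theory Submission
  imports Defs
begin

text \<open>
  From a Skolem function of \<open>\<psi>\<close> one gets one of \<open>\<psi>'\<close> by using the function \<open>s y\<close> for both \<open>y\<close> and \<open>y'\<close>.
  Conversely, let \<open>f\<close> and \<open>g\<close> be the functions chosen for \<open>y\<close> and \<open>y'\<close> in \<open>\<psi>'\<close>, and let
  \<open>O\<^bsub>\<phi>\<^sub>1\<^esub>\<close> be disjoint from \<open>O\<^bsub>\<psi>\<setminus>\<psi>\<^sub>1\<^esub>\<close> (the other case is symmetric). Use \<open>f\<close> for those assignments of \<open>D\<^sub>y\<close>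
  under which \<open>\<phi>\<^sub>1\<close> is true for all values of the variables in \<open>O\<^bsub>\<phi>\<^sub>1\<^esub>\<close>, and \<open>g\<close> for all others. In the
  latter case the variables in \<open>O\<^bsub>\<phi>\<^sub>1\<^esub>\<close> can be changed so as to falsify \<open>\<phi>\<^sub>1\<close> without affecting \<open>\<phi>\<^sub>2\<close>
  or the rest of \<open>\<psi>\<close>. As formulas are in negation normal form, \<open>\<psi>\<close> is monotone in \<open>\<psi>\<^sub>1\<close>, hence true.
\<close>

subsection \<open>Boolean functions\<close>

lemma bool_funs_mono: "f \<in> bool_funs W \<Longrightarrow> W \<subseteq> W' \<Longrightarrow> f \<in> bool_funs W'"
  unfolding bool_funs_def by blast

lemma bool_funsD: "f \<in> bool_funs W \<Longrightarrow> (\<And>w. w \<in> W \<Longrightarrow> a w = b w) \<Longrightarrow> f a = f b"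
  unfolding bool_funs_def by blast

lemma bool_funs_empty: "f \<in> bool_funs {} \<longleftrightarrow> (\<exists>c. f = (\<lambda>a. c))"
  unfolding bool_funs_def by (auto intro!: exI[of _ "f undefined"])

lemma supp_subset:
  assumes "f \<in> bool_funs W"
  shows "supp f \<subseteq> W"
proof
  fix v
  assume "v \<in> supp f"
  then obtain a where "f (a(v := False)) \<noteq> f (a(v := True))"
    by (auto simp: supp_def)
  moreover have "f (a(v := False)) = f (a(v := True))" if "v \<notin> W"
    by (rule bool_funsD[OF assms]) (use that in auto)
  ultimately show "v \<in> W"
    by blast
qed

lemma update_notin_supp:
  assumes "v \<notin> supp f"
  shows "f (a(v := x)) = f a"
proof -
  have "f (a(v := False)) = f (a(v := True))"
    using assms unfolding supp_def by blast
  then have "f (a(v := x)) = f (a(v := a v))"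
    by (cases x; cases "a v") simp_all
  then show ?thesis by simp
qed

text \<open>\<open>supp\<close> tests one flip at a time, while \<open>bool_funs\<close> compares
  assignments that may differ in many variables. Finiteness of \<open>F\<close> bridges the gap: the
  variables of \<open>F - W\<close> are overwritten one by one.\<close>

lemma bool_funs_Int_supp:
  assumes "finite F" "f \<in> bool_funs F" "supp f \<subseteq> W"
  shows "f \<in> bool_funs (W \<inter> F)"
proof -
  have drop: "f (\<lambda>v. if v \<in> S then b v else a v) = f a" if "finite S" "S \<inter> W = {}" for S a b
    using that
  proof (induction S rule: finite_induct)
    case empty
    then show ?case by simp
  next
    case (insert x S)
    let ?c = "\<lambda>v. if v \<in> S then b v else a v"
    have "(\<lambda>v. if v \<in> insert x S then b v else a v) = ?c(x := b x)"
      by (simp add: fun_eq_iff)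
    moreover have "f (?c(x := b x)) = f ?c"
      using insert.prems assms(3) by (intro update_notin_supp) auto
    ultimately show ?case
      using insert by simp
  qed
  show ?thesis
    unfolding bool_funs_def
  proof (clarify)
    fix a b :: "'a \<Rightarrow> bool"
    assume ab: "\<forall>w\<in>W \<inter> F. a w = b w"
    \<comment> \<open>The intermediate assignment coincides with \<open>b\<close> on all of
      \<open>F\<close>: on \<open>F - W\<close> by construction, on \<open>W \<inter> F\<close> by
      \<open>ab\<close>.\<close>
    have "f a = f (\<lambda>v. if v \<in> F - W then b v else a v)"
      by (rule drop[symmetric]) (use assms(1) in auto)
    also have "\<dots> = f b"
      by (rule bool_funsD[OF assms(2)]) (use ab in auto)
    finally show "f a = f b" .
  qed
qed

lemma bool_funs_Int:
  assumes "finite F"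
  shows "f \<in> bool_funs F \<and> supp f \<subseteq> W \<inter> F \<longleftrightarrow> f \<in> bool_funs (W \<inter> F)"
  using bool_funs_Int_supp[OF assms, of f W] bool_funs_mono[of f "W \<inter> F" F] supp_subset[of f "W \<inter> F"]
  by blast

text \<open>In the application, \<open>P\<close> and \<open>Q\<close> are the truth of the two
  disjuncts under the choices \<open>f\<close> and \<open>g\<close>, \<open>W\<close> is the
  universal part of \<open>Dy\<close>, and \<open>A\<close>, \<open>B\<close>, \<open>C\<close> are
  the \<open>O\<close>-sets of the two disjuncts and of the rest. The merged formula at
  \<open>a\<close> is compared with the split one at \<open>c\<close>, which the rest cannot tell
  from \<open>a\<close>. Keeping the sets abstract lets the disjuncts be exchanged later.\<close>

lemma choose_disjunct:
  assumes f: "f \<in> bool_funs W" and g: "g \<in> bool_funs W"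
    and P: "P \<in> bool_funs (A \<union> W)" and Q: "Q \<in> bool_funs (B \<union> W)"
    and disj: "A \<inter> W = {}" "A \<inter> B = {}" "A \<inter> C = {}"
  obtains h where "h \<in> bool_funs W"
    and "\<And>a. \<exists>c. (\<forall>v\<in>C. c v = a v) \<and> (P c \<or> Q c \<longrightarrow> P a \<and> h a = f a \<or> Q a \<and> h a = g a)"
proof
  define agree where "agree a b \<longleftrightarrow> (\<forall>w\<in>W. a w = b w)" for a b :: "'a \<Rightarrow> bool"
  \<comment> \<open>The test refers to \<open>a\<close> only through \<open>agree\<close>, so
    \<open>h\<close> inherits from \<open>f\<close> and \<open>g\<close> that it depends on
    \<open>W\<close> alone.\<close>
  define h where "h a = (if \<forall>b. agree a b \<longrightarrow> P b then f a else g a)" for a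
  show "h \<in> bool_funs W"
    unfolding bool_funs_def
  proof (clarify)
    fix a b :: "'a \<Rightarrow> bool"
    assume ab: "\<forall>w\<in>W. a w = b w"
    then have "agree a = agree b"
      by (auto simp: agree_def fun_eq_iff)
    then show "h a = h b"
      using ab bool_funsD[OF f, of a b] bool_funsD[OF g, of a b] by (auto simp only: h_def)
  qed
  show "\<exists>c. (\<forall>v\<in>C. c v = a v) \<and> (P c \<or> Q c \<longrightarrow> P a \<and> h a = f a \<or> Q a \<and> h a = g a)" for a
  proof (cases "\<forall>b. agree a b \<longrightarrow> P b")
    case True
    then have "P a \<and> h a = f a"
      by (simp add: h_def agree_def)
    \<comment> \<open>Here the witness for \<open>c\<close> is \<open>a\<close> itself.\<close>
    then show ?thesis by blast
  next
    case False
    then obtain b where b: "agree a b" "\<not> P b" by blast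
    \<comment> \<open>On \<open>A \<union> W\<close> this agrees with \<open>b\<close>, so
      \<open>P\<close> fails; on \<open>B \<union> W\<close> and on \<open>C\<close> it agrees with
      \<open>a\<close>, as \<open>A\<close> is disjoint from these sets.\<close>
    define c where "c v = (if v \<in> A then b v else a v)" for v
    have "P c = P b"
      by (rule bool_funsD[OF P]) (use b(1) in \<open>auto simp: c_def agree_def\<close>)
    moreover have "Q c = Q a"
      by (rule bool_funsD[OF Q]) (use disj in \<open>auto simp: c_def\<close>)
    moreover have "h a = g a"
      unfolding h_def using False by (rule if_not_P)
    moreover have "\<forall>v\<in>C. c v = a v"
      using disj(3) by (auto simp: c_def)
    ultimately show ?thesis
      using b(2) by blast
  qed
qed

subsection \<open>Formulas\<close>

lemma quant_vars_simps [simp]: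
  "quant_vars ZeroF = {}"
  "quant_vars (PosF v) = {}"
  "quant_vars (NegF v) = {}"
  "quant_vars (AndF \<alpha> \<beta>) = quant_vars \<alpha> \<union> quant_vars \<beta>"
  "quant_vars (OrF \<alpha> \<beta>) = quant_vars \<alpha> \<union> quant_vars \<beta>"
  "quant_vars (ExF v D \<alpha>) = insert v (quant_vars \<alpha>)"
  "quant_vars (AllF v \<alpha>) = insert v (quant_vars \<alpha>)"
  by (auto simp: quant_vars_def)

lemma vars_simps [simp]:
  "vars ZeroF = {}"
  "vars (PosF v) = {v}"
  "vars (NegF v) = {v}"
  "vars (AndF \<alpha> \<beta>) = vars \<alpha> \<union> vars \<beta>"
  "vars (OrF \<alpha> \<beta>) = vars \<alpha> \<union> vars \<beta>"
  "vars (ExF v D \<alpha>) = insert v (vars \<alpha>)"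
  "vars (AllF v \<alpha>) = insert v (vars \<alpha>)"
  by (auto simp: vars_def)

lemma exists_subset_quant: "exists_vars \<phi> \<subseteq> quant_vars \<phi>"
  by (simp add: quant_vars_def)

lemma quant_subset_vars: "quant_vars \<phi> \<subseteq> vars \<phi>"
  by (simp add: vars_def)

lemma finite_forall_vars: "finite (forall_vars \<phi>)"
  by (induction \<phi>) auto

lemma dep_not_exists: "v \<notin> exists_vars \<phi> \<Longrightarrow> dep \<phi> v = {}"
  by (induction \<phi>) auto

lemma subformula_quant: "\<chi> \<in> subformulas \<phi> \<Longrightarrow> quant_vars \<chi> \<subseteq> quant_vars \<phi>"
  by (induction \<phi>) auto

lemma subformula_vars: "\<chi> \<in> subformulas \<phi> \<Longrightarrow> vars \<chi> \<subseteq> vars \<phi>"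
  by (induction \<phi>) auto

lemma subformula_exists: "\<chi> \<in> subformulas \<phi> \<Longrightarrow> exists_vars \<chi> \<subseteq> exists_vars \<phi>"
  by (induction \<phi>) auto

lemma subformula_dep: "\<chi> \<in> subformulas \<phi> \<Longrightarrow> dep \<chi> v \<subseteq> dep \<phi> v"
  by (induction \<phi>) auto

section \<open>Variables quantified at most once\<close>

text \<open>An invariant of \<open>dqbf\<close> that ignores dependency sets, so
  \<open>remove_dep\<close> does not disturb it, and that passes to subformulas by mere
  simplification, without inverting the rules of \<open>dqbf\<close>.\<close>

primrec quantified_once :: "'v form \<Rightarrow> bool" where
  "quantified_once ZeroF = True"
| "quantified_once (PosF v) = True"
| "quantified_once (NegF v) = True"
| "quantified_once (AndF \<alpha> \<beta>) = (quantified_once \<alpha> \<and> quantified_once \<beta> \<and>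
     vars \<alpha> \<inter> quant_vars \<beta> = {} \<and> vars \<beta> \<inter> quant_vars \<alpha> = {})"
| "quantified_once (OrF \<alpha> \<beta>) = (quantified_once \<alpha> \<and> quantified_once \<beta> \<and>
     vars \<alpha> \<inter> quant_vars \<beta> = {} \<and> vars \<beta> \<inter> quant_vars \<alpha> = {})"
| "quantified_once (ExF v D \<alpha>) = (quantified_once \<alpha> \<and> v \<notin> quant_vars \<alpha>)"
| "quantified_once (AllF v \<alpha>) = (quantified_once \<alpha> \<and> v \<notin> quant_vars \<alpha>)"

lemma quant_vars_remove_dep [simp]: "quant_vars (remove_dep v \<phi>) = quant_vars \<phi>"
  by (induction \<phi>) auto

lemma vars_remove_dep [simp]: "vars (remove_dep v \<phi>) = vars \<phi>"
  by (induction \<phi>) auto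

lemma quantified_once_remove_dep [simp]: "quantified_once (remove_dep v \<phi>) = quantified_once \<phi>"
  by (induction \<phi>) auto

lemma dqbf_quantified_once: "\<phi> \<in> dqbf V \<Longrightarrow> quantified_once \<phi>"
  by (induction rule: dqbf.induct) (auto simp: free_vars_def combinable_def vars_def)

lemma dqbf_vars: "\<phi> \<in> dqbf V \<Longrightarrow> vars \<phi> \<subseteq> V"
  by (induction rule: dqbf.induct) (auto simp: free_vars_def)

text \<open>\<open>dep\<close> unites the dependency sets of all quantifiers of \<open>v\<close>. As
  \<open>v\<close> is quantified inside \<open>\<chi>\<close>, no quantifier outside
  \<open>\<chi>\<close> can contribute.\<close>

lemma dep_subformula_exists:
  assumes "quantified_once \<phi>" "\<chi> \<in> subformulas \<phi>" "v \<in> exists_vars \<chi>"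
  shows "dep \<phi> v = dep \<chi> v"
  using assms(1,2)
proof (induction \<phi>)
  case (AndF \<alpha> \<beta>)
  have notin: "v \<notin> exists_vars \<beta>" if "v \<in> exists_vars \<alpha>"
    using AndF.prems(1) that exists_subset_quant[of \<alpha>] exists_subset_quant[of \<beta>] quant_subset_vars[of \<alpha>]
    unfolding quantified_once.simps by blast
  consider "\<chi> = AndF \<alpha> \<beta>" | "\<chi> \<in> subformulas \<alpha>" | "\<chi> \<in> subformulas \<beta>"
    using AndF.prems(2) by auto
  then show ?case
  proof cases
    case 2
    have "v \<in> exists_vars \<alpha>"
      by (rule subsetD[OF subformula_exists[OF 2] assms(3)])
    then show ?thesis
      using AndF 2 dep_not_exists[OF notin] by simp
  next
    case 3
    have "v \<in> exists_vars \<beta>"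
      by (rule subsetD[OF subformula_exists[OF 3] assms(3)])
    then have "v \<notin> exists_vars \<alpha>"
      using notin by blast
    then show ?thesis
      using AndF 3 dep_not_exists[of v \<alpha>] by simp
  qed simp
next
  case (OrF \<alpha> \<beta>)
  have notin: "v \<notin> exists_vars \<beta>" if "v \<in> exists_vars \<alpha>"
    using OrF.prems(1) that exists_subset_quant[of \<alpha>] exists_subset_quant[of \<beta>] quant_subset_vars[of \<alpha>]
    unfolding quantified_once.simps by blast
  consider "\<chi> = OrF \<alpha> \<beta>" | "\<chi> \<in> subformulas \<alpha>" | "\<chi> \<in> subformulas \<beta>"
    using OrF.prems(2) by auto
  then show ?case
  proof cases
    case 2
    have "v \<in> exists_vars \<alpha>"
      by (rule subsetD[OF subformula_exists[OF 2] assms(3)])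
    then show ?thesis
      using OrF 2 dep_not_exists[OF notin] by simp
  next
    case 3
    have "v \<in> exists_vars \<beta>"
      by (rule subsetD[OF subformula_exists[OF 3] assms(3)])
    then have "v \<notin> exists_vars \<alpha>"
      using notin by blast
    then show ?thesis
      using OrF 3 dep_not_exists[of v \<alpha>] by simp
  qed simp
next
  case (ExF w D \<alpha>)
  show ?case
  proof (cases "\<chi> = ExF w D \<alpha>")
    case False
    then have \<chi>: "\<chi> \<in> subformulas \<alpha>"
      using ExF.prems(2) by simp
    then have "v \<in> quant_vars \<alpha>"
      using subsetD[OF subformula_exists[OF \<chi>] assms(3)] exists_subset_quant[of \<alpha>] by blast
    then show ?thesis
      using ExF \<chi> by auto
  qed simp
qed auto

lemma rename_var_simps [simp]:
  "exists_vars (rename_var y' y \<phi>) = exists_vars \<phi>"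
  "forall_vars (rename_var y' y \<phi>) = forall_vars \<phi>"
  "dep (rename_var y' y \<phi>) v = dep \<phi> v"
  by (induction \<phi>) auto

section \<open>Replacement of a subformula\<close>

lemma replace_not_subformula: "\<psi>1 \<notin> subformulas \<psi> \<Longrightarrow> replace \<chi> \<psi>1 \<psi> = \<psi>"
  by (induction \<psi>) auto

lemma replace_whole [simp]: "replace \<chi> \<psi> \<psi> = \<chi>"
  by (cases \<psi>) auto

text \<open>Presents \<open>\<psi>\<close> in the same shape as \<open>\<psi>'\<close>, so that one
  monotonicity lemma compares them in both directions.\<close>

lemma replace_self [simp]: "replace \<psi>1 \<psi>1 \<psi> = \<psi>"
  by (induction \<psi>) auto

text \<open>\<open>A\<close> stands for the newly quantified variables, \<open>{y'}\<close> in the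
  application. They reach the result only if \<open>\<psi>1\<close> really occurs.\<close>

lemma exists_vars_replace:
  assumes "\<psi>1 \<in> subformulas \<psi>" "exists_vars \<chi> = A \<union> exists_vars \<psi>1"
  shows "exists_vars (replace \<chi> \<psi>1 \<psi>) = A \<union> exists_vars \<psi>"
  using assms(1)
proof (induction \<psi>)
  case (AndF \<alpha> \<beta>)
  show ?case
  proof (cases "AndF \<alpha> \<beta> = \<psi>1")
    case True
    then show ?thesis
      using assms(2) by simp
  next
    case False
    then show ?thesis
      using AndF replace_not_subformula[of \<psi>1 \<alpha> \<chi>] replace_not_subformula[of \<psi>1 \<beta> \<chi>]
      by (cases "\<psi>1 \<in> subformulas \<alpha>"; cases "\<psi>1 \<in> subformulas \<beta>") (simp_all add: Un_ac)
  qed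
next
  case (OrF \<alpha> \<beta>)
  show ?case
  proof (cases "OrF \<alpha> \<beta> = \<psi>1")
    case True
    then show ?thesis
      using assms(2) by simp
  next
    case False
    then show ?thesis
      using OrF replace_not_subformula[of \<psi>1 \<alpha> \<chi>] replace_not_subformula[of \<psi>1 \<beta> \<chi>]
      by (cases "\<psi>1 \<in> subformulas \<alpha>"; cases "\<psi>1 \<in> subformulas \<beta>") (simp_all add: Un_ac)
  qed
next
  case (ExF v D \<alpha>)
  then show ?case
    using assms(2) by (cases "ExF v D \<alpha> = \<psi>1") (simp, simp only: replace.simps, auto)
next
  case (AllF v \<alpha>)
  then show ?case
    using assms(2) by (cases "AllF v \<alpha> = \<psi>1") (simp, simp only: replace.simps, auto)
qed (use assms(2) in auto)

lemma forall_vars_replace: "forall_vars \<chi> = forall_vars \<psi>1 \<Longrightarrow> forall_vars (replace \<chi> \<psi>1 \<psi>) = forall_vars \<psi>"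
  by (induction \<psi>) auto

lemma dep_replace: "dep \<chi> v = dep \<psi>1 v \<Longrightarrow> dep (replace \<chi> \<psi>1 \<psi>) v = dep \<psi> v"
  by (induction \<psi>) auto

text \<open>Complements \<open>dep_replace\<close> for the fresh variable: nothing outside the
  replaced position contributes to its dependency set.\<close>

lemma dep_replace_new:
  assumes "\<psi>1 \<in> subformulas \<psi>" "dep \<psi> v = {}"
  shows "dep (replace \<chi> \<psi>1 \<psi>) v = dep \<chi> v"
  using assms
proof (induction \<psi>)
  case (AndF \<alpha> \<beta>)
  show ?case
  proof (cases "AndF \<alpha> \<beta> = \<psi>1")
    case True
    then show ?thesis
      by simp
  next
    case False
    then show ?thesis
      using AndF replace_not_subformula[of \<psi>1 \<alpha> \<chi>] replace_not_subformula[of \<psi>1 \<beta> \<chi>]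
      by (cases "\<psi>1 \<in> subformulas \<alpha>"; cases "\<psi>1 \<in> subformulas \<beta>") simp_all
  qed
next
  case (OrF \<alpha> \<beta>)
  show ?case
  proof (cases "OrF \<alpha> \<beta> = \<psi>1")
    case True
    then show ?thesis
      by simp
  next
    case False
    then show ?thesis
      using OrF replace_not_subformula[of \<psi>1 \<alpha> \<chi>] replace_not_subformula[of \<psi>1 \<beta> \<chi>]
      by (cases "\<psi>1 \<in> subformulas \<alpha>"; cases "\<psi>1 \<in> subformulas \<beta>") simp_all
  qed
qed (auto split: if_splits)

lemma vars_replace_ZeroF: "vars (replace ZeroF \<psi>1 \<psi>) \<subseteq> vars \<psi>"
  by (induction \<psi>) auto

lemma exists_vars_replace_ZeroF: "exists_vars \<psi> \<subseteq> exists_vars (replace ZeroF \<psi>1 \<psi>) \<union> exists_vars \<psi>1"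
  by (induction \<psi>) auto

lemma forall_vars_replace_ZeroF: "forall_vars \<psi> \<subseteq> forall_vars (replace ZeroF \<psi>1 \<psi>) \<union> forall_vars \<psi>1"
  by (induction \<psi>) auto

text \<open>At a conjunction or disjunction, the operand beside the one containing
  \<open>\<psi>1\<close> has no variable quantified there; a quantifier above \<open>\<psi>1\<close>
  binds a variable that is not bound again below.\<close>

lemma vars_rest_disjoint_quant:
  assumes "quantified_once \<psi>" "\<psi>1 \<in> subformulas \<psi>"
  shows "vars (replace ZeroF \<psi>1 \<psi>) \<inter> quant_vars \<psi>1 = {}"
  using assms
proof (induction \<psi>)
  case (AndF \<alpha> \<beta>)
  show ?case
  proof (cases "AndF \<alpha> \<beta> = \<psi>1")
    case False
    have "vars (replace ZeroF \<psi>1 \<alpha>) \<inter> quant_vars \<psi>1 = {}"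
    proof (cases "\<psi>1 \<in> subformulas \<alpha>")
      case True
      then show ?thesis
        using AndF by simp
    next
      case not_sub: False
      then have "\<psi>1 \<in> subformulas \<beta>"
        using False AndF.prems(2) by auto
      then show ?thesis
        using subformula_quant[of \<psi>1 \<beta>] vars_replace_ZeroF[of \<psi>1 \<alpha>] AndF.prems(1)
        unfolding quantified_once.simps by blast
    qed
    moreover have "vars (replace ZeroF \<psi>1 \<beta>) \<inter> quant_vars \<psi>1 = {}"
    proof (cases "\<psi>1 \<in> subformulas \<beta>")
      case True
      then show ?thesis
        using AndF by simp
    next
      case not_sub: False
      then have "\<psi>1 \<in> subformulas \<alpha>"
        using False AndF.prems(2) by auto
      then show ?thesis
        using subformula_quant[of \<psi>1 \<alpha>] vars_replace_ZeroF[of \<psi>1 \<beta>] AndF.prems(1)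
        unfolding quantified_once.simps by blast
    qed
    ultimately show ?thesis
      using False by (simp add: Int_Un_distrib2)
  qed simp
next
  case (OrF \<alpha> \<beta>)
  show ?case
  proof (cases "OrF \<alpha> \<beta> = \<psi>1")
    case False
    have "vars (replace ZeroF \<psi>1 \<alpha>) \<inter> quant_vars \<psi>1 = {}"
    proof (cases "\<psi>1 \<in> subformulas \<alpha>")
      case True
      then show ?thesis
        using OrF by simp
    next
      case not_sub: False
      then have "\<psi>1 \<in> subformulas \<beta>"
        using False OrF.prems(2) by auto
      then show ?thesis
        using subformula_quant[of \<psi>1 \<beta>] vars_replace_ZeroF[of \<psi>1 \<alpha>] OrF.prems(1)
        unfolding quantified_once.simps by blast
    qed
    moreover have "vars (replace ZeroF \<psi>1 \<beta>) \<inter> quant_vars \<psi>1 = {}"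
    proof (cases "\<psi>1 \<in> subformulas \<beta>")
      case True
      then show ?thesis
        using OrF by simp
    next
      case not_sub: False
      then have "\<psi>1 \<in> subformulas \<alpha>"
        using False OrF.prems(2) by auto
      then show ?thesis
        using subformula_quant[of \<psi>1 \<alpha>] vars_replace_ZeroF[of \<psi>1 \<beta>] OrF.prems(1)
        unfolding quantified_once.simps by blast
    qed
    ultimately show ?thesis
      using False by (simp add: Int_Un_distrib2)
  qed simp
next
  case (ExF v D \<alpha>)
  show ?case
  proof (cases "ExF v D \<alpha> = \<psi>1")
    case False
    then have "\<psi>1 \<in> subformulas \<alpha>"
      using ExF.prems(2) by auto
    then show ?thesis
      using ExF subformula_quant[of \<psi>1 \<alpha>] False by auto
  qed simp
next
  case (AllF v \<alpha>)
  show ?case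
  proof (cases "AllF v \<alpha> = \<psi>1")
    case False
    then have "\<psi>1 \<in> subformulas \<alpha>"
      using AllF.prems(2) by auto
    then show ?thesis
      using AllF subformula_quant[of \<psi>1 \<alpha>] False by auto
  qed simp
qed auto

subsection \<open>Evaluation\<close>

primrec holds :: "('v \<Rightarrow> bool) \<Rightarrow> 'v form \<Rightarrow> bool" where
  "holds e ZeroF = False"
| "holds e (PosF v) = e v"
| "holds e (NegF v) = (\<not> e v)"
| "holds e (AndF \<alpha> \<beta>) = (holds e \<alpha> \<and> holds e \<beta>)"
| "holds e (OrF \<alpha> \<beta>) = (holds e \<alpha> \<or> holds e \<beta>)"
| "holds e (ExF v D \<alpha>) = holds e \<alpha>"
| "holds e (AllF v \<alpha>) = holds e \<alpha>"

text \<open>Moves the Skolem functions from the formula into the assignment, so that comparing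
  candidates becomes comparing assignments for \<open>holds\<close>.\<close>

definition skolem_env :: "'v set \<Rightarrow> ('v \<Rightarrow> ('v \<Rightarrow> bool) \<Rightarrow> bool) \<Rightarrow> ('v \<Rightarrow> bool) \<Rightarrow> 'v \<Rightarrow> bool" where
  "skolem_env X s a v = (if v \<in> X then s v a else a v)"

lemma apply_skolem_eq_holds: "apply_skolem X s \<phi> a = holds (skolem_env X s a) \<phi>"
  by (induction \<phi>) (auto simp: skolem_env_def)

lemma holds_cong: "(\<And>v. v \<in> vars \<phi> \<Longrightarrow> e v = e' v) \<Longrightarrow> holds e \<phi> = holds e' \<phi>"
  by (induction \<phi>) auto

lemma holds_rename_var:
  assumes "y' \<notin> vars \<phi>"
  shows "holds e (rename_var y' y \<phi>) = holds (e(y := e y')) \<phi>"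
  using assms by (induction \<phi>) auto

text \<open>In negation normal form no replaced position lies below a negation. The two assignments
  need to agree only on the rest; what they do inside the replaced part is covered by the second
  premise.\<close>

lemma holds_replace_mono:
  assumes "\<And>v. v \<in> vars (replace ZeroF \<psi>1 \<psi>) \<Longrightarrow> e v = e' v"
    and "holds e \<chi> \<Longrightarrow> holds e' \<chi>'"
    and "holds e (replace \<chi> \<psi>1 \<psi>)"
  shows "holds e' (replace \<chi>' \<psi>1 \<psi>)"
  using assms(1,3)
proof (induction \<psi>)
  case (AndF \<alpha> \<beta>)
  then show ?case
    using assms(2) by (cases "AndF \<alpha> \<beta> = \<psi>1") (simp, simp only: replace.simps, force)
next
  case (OrF \<alpha> \<beta>)
  then show ?case
    using assms(2) by (cases "OrF \<alpha> \<beta> = \<psi>1") (simp, simp only: replace.simps, force)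
next
  case (ExF v D \<alpha>)
  then show ?case
    using assms(2) by (cases "ExF v D \<alpha> = \<psi>1") (simp, simp only: replace.simps, force)
next
  case (AllF v \<alpha>)
  then show ?case
    using assms(2) by (cases "AllF v \<alpha> = \<psi>1") (simp, simp only: replace.simps, force)
qed (use assms(2) in \<open>auto split: if_splits\<close>)

text \<open>A formula has finitely many universal variables, so range and support conditions merge
  into one membership in \<open>bool_funs\<close>; being constant is the case of the empty
  set.\<close>

lemma skolem_candidates_iff:
  "s \<in> skolem_candidates V \<psi> \<longleftrightarrow>
     s \<in> extensional (free_vars V \<psi> \<union> exists_vars \<psi>) \<and>
     (\<forall>v\<in>free_vars V \<psi>. s v \<in> bool_funs {}) \<and>
     (\<forall>v\<in>exists_vars \<psi>. s v \<in> bool_funs (dep \<psi> v \<inter> forall_vars \<psi>))"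
proof -
  let ?B = "bool_funs (forall_vars \<psi>)"
  have "(\<exists>c. s v = (\<lambda>a. c)) \<longleftrightarrow> s v \<in> ?B \<and> s v \<in> bool_funs {}" for v
    unfolding bool_funs_empty[symmetric] by (blast intro: bool_funs_mono)
  moreover have "s v \<in> bool_funs (dep \<psi> v \<inter> forall_vars \<psi>) \<longleftrightarrow>
      s v \<in> ?B \<and> supp (s v) \<subseteq> dep \<psi> v \<inter> forall_vars \<psi>" for v
    by (rule bool_funs_Int[OF finite_forall_vars, symmetric])
  moreover have "s v \<in> bool_funs {} \<Longrightarrow> s v \<in> ?B" for v
    by (rule bool_funs_mono[OF _ empty_subsetI])
  ultimately show ?thesis
    unfolding skolem_candidates_def PiE_def Pi_def by (simp only: mem_Collect_eq Int_iff) blast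
qed

lemma skolem_funs_iff:
  "s \<in> skolem_funs V \<psi> \<longleftrightarrow> s \<in> skolem_candidates V \<psi> \<and>
     (\<forall>a. holds (skolem_env (free_vars V \<psi> \<union> exists_vars \<psi>) s a) \<psi>)"
  by (simp add: skolem_funs_def apply_skolem_eq_holds)

subsection \<open>Splitting the quantifier\<close>

locale split_exists =
  fixes V :: "'v set" and \<psi> \<psi>1 \<psi>2 \<phi>1 \<phi>2 :: "'v form" and y y' :: 'v and Dy :: "'v set"
  assumes dqbf: "\<psi> \<in> dqbf V"
    and \<psi>1: "\<psi>1 = ExF y Dy (OrF \<phi>1 \<phi>2)"
    and sub: "\<psi>1 \<in> subformulas \<psi>"
    and fresh: "fresh y' \<psi>"
    and \<psi>2: "\<psi>2 = OrF (ExF y Dy \<phi>1) (ExF y' Dy (rename_var y' y \<phi>2))"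
begin

abbreviation "\<psi>' \<equiv> replace \<psi>2 \<psi>1 \<psi>"
abbreviation "rest \<equiv> replace ZeroF \<psi>1 \<psi>"
abbreviation "X \<equiv> free_vars V \<psi> \<union> exists_vars \<psi>"
abbreviation "X' \<equiv> free_vars (insert y' V) \<psi>' \<union> exists_vars \<psi>'"

lemma y'_notin: "y' \<notin> vars \<psi>" "y' \<notin> exists_vars \<psi>" "y' \<notin> quant_vars \<psi>"
  using fresh exists_subset_quant quant_subset_vars by (fastforce simp: fresh_def)+

lemma y_exists: "y \<in> exists_vars \<psi>"
  using subformula_exists[OF sub] by (auto simp: \<psi>1)

lemma y_neq: "y \<noteq> y'"
  using y_exists y'_notin by auto

lemma dep_y: "dep \<psi> y = Dy"
proof -
  have "y \<in> exists_vars \<psi>1"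
    by (simp add: \<psi>1)
  then have "dep \<psi> y = dep \<psi>1 y"
    using dep_subformula_exists[OF dqbf_quantified_once[OF dqbf] sub] by simp
  moreover have "quantified_once \<chi>" if "\<chi> \<in> subformulas \<phi>" "quantified_once \<phi>" for \<chi> \<phi> :: "'v form"
    using that by (induction \<phi>) auto
  then have "quantified_once \<psi>1"
    using sub dqbf_quantified_once[OF dqbf] by blast
  then have "y \<notin> exists_vars (OrF \<phi>1 \<phi>2)"
    using exists_subset_quant[of "OrF \<phi>1 \<phi>2"] unfolding \<psi>1 quantified_once.simps(6) by blast
  then have "dep \<psi>1 y = Dy"
    using dep_not_exists[of y "OrF \<phi>1 \<phi>2"] unfolding \<psi>1 dep.simps(6) by simp
  ultimately show ?thesis by simp
qed

lemma vars_sub: "vars \<phi>1 \<subseteq> vars \<psi>" "vars \<phi>2 \<subseteq> vars \<psi>"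
  using subformula_vars[OF sub] by (auto simp: \<psi>1)

lemma exists_\<psi>' [simp]: "exists_vars \<psi>' = insert y' (exists_vars \<psi>)"
  using exists_vars_replace[OF sub, of \<psi>2 "{y'}"] by (auto simp: \<psi>1 \<psi>2)

lemma forall_\<psi>' [simp]: "forall_vars \<psi>' = forall_vars \<psi>"
  using forall_vars_replace[of \<psi>2 \<psi>1 \<psi>] by (simp add: \<psi>1 \<psi>2)

lemma dep_\<psi>': "v \<noteq> y' \<Longrightarrow> dep \<psi>' v = dep \<psi> v"
  by (rule dep_replace) (auto simp: \<psi>1 \<psi>2)

lemma dep_\<psi>'_y' [simp]: "dep \<psi>' y' = Dy"
proof -
  have "dep \<psi> y' = {}"
    by (rule dep_not_exists[OF y'_notin(2)])
  moreover from this have "dep \<psi>1 y' = {}"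
    using subformula_dep[OF sub, of y'] by simp
  ultimately show ?thesis
    using dep_replace_new[OF sub, of y' \<psi>2] y_neq by (auto simp: \<psi>1 \<psi>2)
qed

text \<open>Freshness does not exclude that \<open>y'\<close> already belongs to \<open>V\<close>;
  it is then free for \<open>\<psi>\<close> but existential in \<open>\<psi>'\<close>, hence the
  difference.\<close>

lemma free_\<psi>' [simp]: "free_vars (insert y' V) \<psi>' = free_vars V \<psi> - {y'}"
  by (auto simp: free_vars_def quant_vars_def)

text \<open>What \<open>\<psi>1\<close> quantifies does not occur outside it. So a quantified
  variable of \<open>\<psi>\<close> that occurs in \<open>rest\<close> is quantified in
  \<open>rest\<close>, and \<open>O_rest\<close> accounts for it.\<close>

lemma rest_vars: "vars rest \<subseteq> vars \<psi>" "y \<notin> vars rest" "y' \<notin> vars rest"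
  "vars rest \<inter> exists_vars \<psi> \<subseteq> exists_vars rest"
  "vars rest \<inter> forall_vars \<psi> \<subseteq> forall_vars rest"
proof -
  have *: "vars rest \<inter> quant_vars \<psi>1 = {}"
    using vars_rest_disjoint_quant[OF dqbf_quantified_once[OF dqbf] sub] .
  show "vars rest \<subseteq> vars \<psi>"
    by (rule vars_replace_ZeroF)
  then show "y' \<notin> vars rest"
    using y'_notin by auto
  show "y \<notin> vars rest"
    using * by (auto simp: \<psi>1)
  show "vars rest \<inter> exists_vars \<psi> \<subseteq> exists_vars rest"
    using * exists_vars_replace_ZeroF[of \<psi> \<psi>1] unfolding quant_vars_def by blast
  show "vars rest \<inter> forall_vars \<psi> \<subseteq> forall_vars rest"
    using * forall_vars_replace_ZeroF[of \<psi> \<psi>1] unfolding quant_vars_def by blast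
qed

section \<open>Skolem functions of \<open>\<psi>'\<close> from those of
  \<open>\<psi>\<close>\<close>

lemma split_skolem:
  assumes s: "s \<in> skolem_funs V \<psi>"
  shows "skolem_funs (insert y' V) \<psi>' \<noteq> {}"
proof -
  define s' where "s' = s(y' := s y)"
  have cand: "s \<in> skolem_candidates V \<psi>"
    using s by (simp add: skolem_funs_iff)
  have "s' \<in> skolem_candidates (insert y' V) \<psi>'"
    using cand y_exists y_neq y'_notin
    by (auto simp: skolem_candidates_iff s'_def extensional_def dep_y dep_\<psi>')
  moreover have "holds (skolem_env X' s' a) \<psi>'" for a
  proof (rule holds_replace_mono[of \<psi>1 \<psi> "skolem_env X s a" _ \<psi>1])
    \<comment> \<open>The two environments can differ only at \<open>y'\<close>, which does not
      occur in \<open>\<psi>\<close>.\<close>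
    have eq: "skolem_env X s a v = skolem_env X' s' a v" if "v \<in> vars \<psi>" for v
      using that y'_notin by (auto simp: skolem_env_def s'_def)
    show "skolem_env X s a v = skolem_env X' s' a v" if "v \<in> vars rest" for v
      using eq rest_vars that by blast
    have "holds (skolem_env X' s' a) \<phi>1 = holds (skolem_env X s a) \<phi>1"
      by (rule holds_cong) (use eq vars_sub in force)
    moreover have "holds (skolem_env X' s' a) (rename_var y' y \<phi>2) = holds (skolem_env X s a) \<phi>2"
    proof -
      have "skolem_env X' s' a y' = skolem_env X s a y"
        using y_exists by (auto simp: skolem_env_def s'_def)
      then have "((skolem_env X' s' a)(y := skolem_env X' s' a y')) v = skolem_env X s a v"
        if "v \<in> vars \<phi>2" for v
        using eq[OF subsetD[OF vars_sub(2) that]] by (cases "v = y") auto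
      moreover have "y' \<notin> vars \<phi>2"
        using y'_notin vars_sub by blast
      ultimately show ?thesis
        using holds_cong by (subst holds_rename_var) blast+
    qed
    ultimately show "holds (skolem_env X' s' a) \<psi>2" if "holds (skolem_env X s a) \<psi>1"
      using that by (auto simp: \<psi>1 \<psi>2)
    show "holds (skolem_env X s a) (replace \<psi>1 \<psi>1 \<psi>)"
      using s by (simp add: skolem_funs_iff)
  qed
  ultimately have "s' \<in> skolem_funs (insert y' V) \<psi>'"
    unfolding skolem_funs_iff by blast
  then show ?thesis by blast
qed

section \<open>Skolem functions of \<open>\<psi>\<close> from those of
  \<open>\<psi>'\<close>\<close>

lemma merge_skolem:
  assumes s': "s' \<in> skolem_funs (insert y' V) \<psi>'"
    and O12: "O_sub \<psi> Dy \<phi>1 \<inter> O_sub \<psi> Dy \<phi>2 = {}"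
    and Orest: "O_sub \<psi> Dy \<phi>1 \<inter> O_rest \<psi> \<psi>1 = {} \<or> O_sub \<psi> Dy \<phi>2 \<inter> O_rest \<psi> \<psi>1 = {}"
  shows "skolem_funs V \<psi> \<noteq> {}"
proof -
  define W where "W = Dy \<inter> forall_vars \<psi>"
  define E where "E = skolem_env X' s'"
  define f where "f = s' y"
  define g where "g = s' y'"
  define P where "P a = holds (E a) \<phi>1" for a
  \<comment> \<open>The value of the renamed second disjunct, expressed through the original
    \<open>\<phi>2\<close> by overwriting \<open>y\<close>.\<close>
  define Q where "Q a = holds ((E a)(y := g a)) \<phi>2" for a
  have cand: "s' \<in> skolem_candidates (insert y' V) \<psi>'"
    using s' by (simp add: skolem_funs_iff)
  have f: "f \<in> bool_funs W" and g: "g \<in> bool_funs W"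
    using cand y_exists y_neq y'_notin
    by (auto simp: skolem_candidates_iff f_def g_def W_def dep_\<psi>' dep_y)
  have E_y: "E a y = f a" "E a y' = g a" for a
    using y_exists by (auto simp: E_def skolem_env_def f_def g_def)
  \<comment> \<open>An existential variable depends on its dependency set, a universal one on
    itself, a free one on nothing; for the latter \<open>{v} \<inter> forall_vars \<psi>\<close> is
    empty.\<close>
  have E_dep: "(\<lambda>a. E a v) \<in> bool_funs (if v \<in> exists_vars \<psi> then dep \<psi> v \<inter> forall_vars \<psi> else {v} \<inter> forall_vars \<psi>)"
    if "v \<in> vars \<psi>" for v
  proof -
    have "v \<noteq> y'" "v \<in> V"
      using that y'_notin dqbf_vars[OF dqbf] by auto
    consider "v \<in> exists_vars \<psi>" | "v \<in> free_vars V \<psi>" "v \<notin> exists_vars \<psi>"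
      | "v \<in> forall_vars \<psi>" "v \<notin> exists_vars \<psi>" "v \<notin> free_vars V \<psi>"
      using \<open>v \<in> V\<close> by (auto simp: free_vars_def quant_vars_def)
    then show ?thesis
    proof cases
      case 1
      then have "s' v \<in> bool_funs (dep \<psi>' v \<inter> forall_vars \<psi>)"
        using cand by (simp add: skolem_candidates_iff)
      then show ?thesis
        using 1 \<open>v \<noteq> y'\<close> by (simp add: E_def skolem_env_def dep_\<psi>')
    next
      case 2
      then have "s' v \<in> bool_funs {}"
        using cand \<open>v \<noteq> y'\<close> by (simp add: skolem_candidates_iff)
      then show ?thesis
        using 2 \<open>v \<noteq> y'\<close> bool_funs_mono[OF _ empty_subsetI]
        by (simp add: E_def skolem_env_def)
    next
      case 3
      then show ?thesis
        using \<open>v \<noteq> y'\<close> by (simp add: E_def skolem_env_def bool_funs_def)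
    qed
  qed
  have E_rest: "(\<lambda>a. E a v) \<in> bool_funs (O_rest \<psi> \<psi>1)" if "v \<in> vars rest" for v
    using that rest_vars by (intro bool_funs_mono[OF E_dep]) (auto simp: O_rest_def)
  \<comment> \<open>\<open>O_sub\<close> leaves out \<open>Dy\<close>; adding \<open>W\<close>
    restores exactly its universal variables.\<close>
  have E_sub: "(\<lambda>a. E a v) \<in> bool_funs (O_sub \<psi> Dy \<phi> \<union> W)"
    if "v \<in> vars \<phi>" "vars \<phi> \<subseteq> vars \<psi>" for v \<phi>
    using that by (intro bool_funs_mono[OF E_dep]) (auto simp: O_sub_def W_def)
  have P: "P \<in> bool_funs (O_sub \<psi> Dy \<phi>1 \<union> W)"
    unfolding bool_funs_def P_def
    by (intro CollectI allI impI holds_cong bool_funsD[OF E_sub[OF _ vars_sub(1)]]) auto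
  have Q: "Q \<in> bool_funs (O_sub \<psi> Dy \<phi>2 \<union> W)"
    unfolding bool_funs_def
  proof (intro CollectI allI impI)
    fix a b :: "'v \<Rightarrow> bool"
    assume ab: "\<forall>w\<in>O_sub \<psi> Dy \<phi>2 \<union> W. a w = b w"
    have "g a = g b"
      by (rule bool_funsD[OF g]) (use ab in auto)
    moreover have "E a v = E b v" if "v \<in> vars \<phi>2" for v
      by (rule bool_funsD[OF E_sub[OF that vars_sub(2)]]) (use ab in auto)
    ultimately show "Q a = Q b"
      unfolding Q_def by (intro holds_cong) simp
  qed
  have OW: "O_sub \<psi> Dy \<phi> \<inter> W = {}" for \<phi>
    by (auto simp: O_sub_def W_def)
  obtain h where h: "h \<in> bool_funs W"
    and choice: "\<And>a. \<exists>c. (\<forall>v\<in>O_rest \<psi> \<psi>1. c v = a v) \<and>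
      (P c \<or> Q c \<longrightarrow> P a \<and> h a = f a \<or> Q a \<and> h a = g a)"
    using Orest
  proof
    assume "O_sub \<psi> Dy \<phi>1 \<inter> O_rest \<psi> \<psi>1 = {}"
    from choose_disjunct[OF f g P Q OW O12 this] show ?thesis
      using that by metis
  next
    assume "O_sub \<psi> Dy \<phi>2 \<inter> O_rest \<psi> \<psi>1 = {}"
    \<comment> \<open>The same choice with the two disjuncts exchanged: now \<open>g\<close> is
      preferred wherever \<open>\<phi>2\<close> holds for all values of its own variables.\<close>
    from choose_disjunct[OF g f Q P OW _ this] show ?thesis
      using that O12 by (metis Int_commute)
  qed
  \<comment> \<open>If \<open>y'\<close> lies in \<open>V\<close>, it is free for
    \<open>\<psi>\<close> and needs a constant, whereas \<open>s' y'\<close> may depend on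
    \<open>Dy\<close>; any constant serves, as \<open>y'\<close> does not occur in
    \<open>\<psi>\<close>.\<close>
  define s where "s = restrict (s'(y' := \<lambda>a. False, y := h)) X"
  have y_not_free: "y \<notin> free_vars V \<psi>"
    using y_exists by (auto simp: free_vars_def quant_vars_def)
  have "s v \<in> bool_funs {}" if "v \<in> free_vars V \<psi>" for v
    using that cand y_not_free by (auto simp: skolem_candidates_iff s_def bool_funs_empty)
  moreover have "s v \<in> bool_funs (dep \<psi> v \<inter> forall_vars \<psi>)" if "v \<in> exists_vars \<psi>" for v
    using that cand h y'_notin by (auto simp: skolem_candidates_iff s_def dep_y W_def dep_\<psi>')
  moreover have "s \<in> extensional X"
    by (simp add: s_def)
  ultimately have "s \<in> skolem_candidates V \<psi>"
    unfolding skolem_candidates_iff by blast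
  moreover have "holds (skolem_env X s a) \<psi>" for a
  proof -
    from choice[of a] obtain c where c: "\<forall>v\<in>O_rest \<psi> \<psi>1. c v = a v"
      "P c \<or> Q c \<longrightarrow> P a \<and> h a = f a \<or> Q a \<and> h a = g a"
      by (elim exE conjE)
    have env: "skolem_env X s a v = ((E a)(y := h a)) v" if "v \<in> vars \<psi>" for v
      using that y'_notin y_exists by (auto simp: skolem_env_def s_def E_def)
    have "holds (skolem_env X s a) (replace \<psi>1 \<psi>1 \<psi>)"
    \<comment> \<open>The truth of \<open>\<psi>'\<close> is used at \<open>c\<close>, not at
      \<open>a\<close>: the variables of \<open>rest\<close> have the same values at both, since
      \<open>c\<close> and \<open>a\<close> agree on \<open>O_rest \<psi> \<psi>1\<close>.\<close>
    proof (rule holds_replace_mono[of \<psi>1 \<psi> "E c" _ \<psi>2])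
      show "E c v = skolem_env X s a v" if "v \<in> vars rest" for v
        using env[OF subsetD[OF rest_vars(1) that]] that rest_vars(2) bool_funsD[OF E_rest[OF that], of c a] c(1)
          by (metis fun_upd_other)
      show "holds (E c) \<psi>'"
        using s' by (simp add: skolem_funs_iff E_def)
      assume "holds (E c) \<psi>2"
      then have "P c \<or> Q c"
        using holds_rename_var[of y' \<phi>2 "E c" y] y'_notin(1) vars_sub(2)
        by (auto simp: \<psi>2 P_def Q_def E_y)
      from c(2)[rule_format, OF this] show "holds (skolem_env X s a) \<psi>1"
      proof
        assume *: "P a \<and> h a = f a"
        have "holds (skolem_env X s a) \<phi>1 = holds (E a) \<phi>1"
          by (rule holds_cong) (use env[OF subsetD[OF vars_sub(1)]] * E_y in simp)
        then show ?thesis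
          using * by (simp add: \<psi>1 P_def)
      next
        assume *: "Q a \<and> h a = g a"
        have "holds (skolem_env X s a) \<phi>2 = holds ((E a)(y := g a)) \<phi>2"
          by (rule holds_cong) (use env[OF subsetD[OF vars_sub(2)]] * in simp)
        then show ?thesis
          using * by (simp add: \<psi>1 Q_def)
      qed
    qed
    then show ?thesis by simp
  qed
  ultimately have "s \<in> skolem_funs V \<psi>"
    unfolding skolem_funs_iff by blast
  then show ?thesis by blast
qed

end

theorem theorem10:
  fixes V :: "'v set" and \<psi> \<psi>1 \<psi>2 \<phi>1 \<phi>2 :: "'v form" and y y' :: 'v and Dy :: "'v set"
  assumes "finite V"
    and "\<psi> \<in> dqbf V"
    and "\<psi>1 = ExF y Dy (OrF \<phi>1 \<phi>2)"
    and "\<psi>1 \<in> subformulas \<psi>"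
    and "fresh y' \<psi>"
    and "\<psi>2 = OrF (ExF y Dy \<phi>1) (ExF y' Dy (rename_var y' y \<phi>2))"
    and "O_sub \<psi> Dy \<phi>1 \<inter> O_sub \<psi> Dy \<phi>2 = {}"
    and "O_sub \<psi> Dy \<phi>1 \<inter> O_rest \<psi> \<psi>1 = {} \<or> O_sub \<psi> Dy \<phi>2 \<inter> O_rest \<psi> \<psi>1 = {}"
  shows "equisat V \<psi> (insert y' V) (replace \<psi>2 \<psi>1 \<psi>)"
proof -
  interpret split_exists V \<psi> \<psi>1 \<psi>2 \<phi>1 \<phi>2 y y' Dy
    by unfold_locales (use assms in auto)
  show ?thesis
    unfolding equisat_def using split_skolem merge_skolem assms(7,8) by blast
qed

end
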